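(* Let $F\colon\mathcal{C}\to\mathcal{D}$ be a functor between small categories, let $X\colon\mathcal{C}\to\mathbf{Set}$ be a functor, and let $\Pi_FX=\operatorname{Ran}_FX\colon\mathcal{D}\to\mathbf{Set}$ be its right Kan extension along $F$. There is a natural bijection $$\operatorname{Sect}(\pi_X)\cong\operatorname{Sect}(\pi_{\Pi_FX}).$$ Consequently, $\mathrm{dsecat}(\pi_X)=0$ if and only if $\mathrm{dsecat}(\pi_{\Pi_FX})=0$.
   Context: For a functor $X\colon\mathcal{C}\to\mathbf{Set}$ on a small category, the category of elements $\int^{\mathcal{C}}X$ has objects $(c,x)$ with $x\in X(c)$; a morphism $(c,x)\to(d,y)$ is a morphism $f\colon c\to d$ in $\mathcal{C}$ with $X(f)(x)=y$. The functor $\pi_X\colon\int^{\mathcal{C}}X\to\mathcal{C}$ is the projection $(c,x)\mapsto c$. $\operatorname{Sect}(\pi_X)$ denotes the set of global sections, i.e. functors $s\colon\mathcal{C}\to\int^{\mathcal{C}}X$ with $\pi_Xs=1_{\mathcal{C}}$. The functor $\Pi_F\colon[\mathcal{C},\mathbf{Set}]\to[\mathcal{D},\mathbf{Set}]$ is right adjoint to precomposition $\Delta_F\colon Y\mapsto Y\circ F$; pointwise, $(\Pi_FX)(d)\cong\lim_{(d\downarrow F)}X\circ q_d$, where $q_d\colon(d\downarrow F)\to\mathcal{C}$ is the projection. A cover of a category $\mathcal{B}$ is a family of (not necessarily full) subcategories such that every morphism of $\mathcal{B}$ belongs to at least one of them. For a functor $P\colon\mathcal{E}\to\mathcal{B}$,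 the directed sectional category $\mathrm{dsecat}(P)$ is the least integer $n\geq0$ for which $\mathcal{B}$ admits a cover $\{\mathcal{U}_0,\dots,\mathcal{U}_n\}$ and, for every $i$, a functor $s_i\colon\mathcal{U}_i\to\mathcal{E}$ together with a natural transformation $P s_i\Rightarrow\iota_i$, where $\iota_i\colon\mathcal{U}_i\hookrightarrow\mathcal{B}$ is the inclusion; it is $\infty$ if no such finite cover exists. *)

theory Defs
  imports "HOL-Library.FuncSet" "HOL-Library.Extended_Nat"
begin

section \<open>Small categories and functors\<close>

record ('o, 'a) cat =
  Obj :: "'o set"
  Arr :: "'a set"
  Dom :: "'a \<Rightarrow> 'o"
  Cod :: "'a \<Rightarrow> 'o"
  Ident :: "'o \<Rightarrow> 'a"
  Comp :: "'a \<Rightarrow> 'a \<Rightarrow> 'a"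

text \<open>\<open>Comp C g f\<close> is the composite ``g after f''. Every category in this sense is small, since
  its objects and its morphisms form sets.\<close>

definition category :: "('o, 'a) cat \<Rightarrow> bool" where
  "category C \<longleftrightarrow>
     (\<forall>f\<in>Arr C. Dom C f \<in> Obj C \<and> Cod C f \<in> Obj C) \<and>
     (\<forall>c\<in>Obj C. Ident C c \<in> Arr C \<and> Dom C (Ident C c) = c \<and> Cod C (Ident C c) = c) \<and>
     (\<forall>f\<in>Arr C. \<forall>g\<in>Arr C. Cod C f = Dom C g \<longrightarrow>
        Comp C g f \<in> Arr C \<and> Dom C (Comp C g f) = Dom C f \<and> Cod C (Comp C g f) = Cod C g) \<and>
     (\<forall>f\<in>Arr C. Comp C f (Ident C (Dom C f)) = f \<and> Comp C (Ident C (Cod C f)) f = f) \<and>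
     (\<forall>f\<in>Arr C. \<forall>g\<in>Arr C. \<forall>h\<in>Arr C. Cod C f = Dom C g \<longrightarrow> Cod C g = Dom C h \<longrightarrow>
        Comp C h (Comp C g f) = Comp C (Comp C h g) f)"

record ('o, 'a, 'p, 'b) func =
  fobj :: "'o \<Rightarrow> 'p"
  farr :: "'a \<Rightarrow> 'b"

text \<open>The two maps of a functor are \<open>undefined\<close> outside the objects and morphisms of the source,
  so that equality of functors is equality in HOL.\<close>

definition is_functor :: "('o, 'a) cat \<Rightarrow> ('p, 'b) cat \<Rightarrow> ('o, 'a, 'p, 'b) func \<Rightarrow> bool" where
  "is_functor C D F \<longleftrightarrow>
     fobj F \<in> Obj C \<rightarrow>\<^sub>E Obj D \<and> farr F \<in> Arr C \<rightarrow>\<^sub>E Arr D \<and>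
     (\<forall>f\<in>Arr C. Dom D (farr F f) = fobj F (Dom C f) \<and> Cod D (farr F f) = fobj F (Cod C f)) \<and>
     (\<forall>c\<in>Obj C. farr F (Ident C c) = Ident D (fobj F c)) \<and>
     (\<forall>f\<in>Arr C. \<forall>g\<in>Arr C. Cod C f = Dom C g \<longrightarrow>
        farr F (Comp C g f) = Comp D (farr F g) (farr F f))"

definition id_functor :: "('o, 'a) cat \<Rightarrow> ('o, 'a, 'o, 'a) func" where
  "id_functor C = \<lparr>fobj = (\<lambda>c\<in>Obj C. c), farr = (\<lambda>f\<in>Arr C. f)\<rparr>"

text \<open>\<open>comp_functor C G F\<close> is ``G after F''; \<open>C\<close> is the source of \<open>F\<close>.\<close>

definition comp_functor ::
  "('o, 'a) cat \<Rightarrow> ('p, 'b, 'q, 'e) func \<Rightarrow> ('o, 'a, 'p, 'b) func \<Rightarrow> ('o, 'a, 'q, 'e) func" where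
  "comp_functor C G F =
     \<lparr>fobj = (\<lambda>c\<in>Obj C. fobj G (fobj F c)), farr = (\<lambda>f\<in>Arr C. farr G (farr F f))\<rparr>"

definition nat_trans ::
  "('o, 'a) cat \<Rightarrow> ('p, 'b) cat \<Rightarrow> ('o, 'a, 'p, 'b) func \<Rightarrow> ('o, 'a, 'p, 'b) func
     \<Rightarrow> ('o \<Rightarrow> 'b) \<Rightarrow> bool" where
  "nat_trans C D F G t \<longleftrightarrow>
     (\<forall>c\<in>Obj C. t c \<in> Arr D \<and> Dom D (t c) = fobj F c \<and> Cod D (t c) = fobj G c) \<and>
     (\<forall>f\<in>Arr C. Comp D (t (Cod C f)) (farr F f) = Comp D (farr G f) (t (Dom C f)))"


section \<open>Set-valued functors\<close>

text \<open>A functor to \<open>Set\<close> takes subsets of an arbitrary type \<open>'x\<close> as values. Different functors may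
  use different value types; this is why they get a record of their own instead of being functors
  to one fixed category of sets.\<close>

record ('o, 'a, 'x) setfun =
  sobj :: "'o \<Rightarrow> 'x set"
  sarr :: "'a \<Rightarrow> 'x \<Rightarrow> 'x"

definition set_functor :: "('o, 'a) cat \<Rightarrow> ('o, 'a, 'x) setfun \<Rightarrow> bool" where
  "set_functor C X \<longleftrightarrow>
     sobj X \<in> extensional (Obj C) \<and> sarr X \<in> extensional (Arr C) \<and>
     (\<forall>f\<in>Arr C. sarr X f \<in> sobj X (Dom C f) \<rightarrow>\<^sub>E sobj X (Cod C f)) \<and>
     (\<forall>c\<in>Obj C. \<forall>x\<in>sobj X c. sarr X (Ident C c) x = x) \<and>
     (\<forall>f\<in>Arr C. \<forall>g\<in>Arr C. Cod C f = Dom C g \<longrightarrow>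
        (\<forall>x\<in>sobj X (Dom C f). sarr X (Comp C g f) x = sarr X g (sarr X f x)))"

definition set_nat ::
  "('o, 'a) cat \<Rightarrow> ('o, 'a, 'x) setfun \<Rightarrow> ('o, 'a, 'y) setfun \<Rightarrow> ('o \<Rightarrow> 'x \<Rightarrow> 'y) set" where
  "set_nat C X Y =
     {t \<in> (\<Pi>\<^sub>E c\<in>Obj C. sobj X c \<rightarrow>\<^sub>E sobj Y c).
        \<forall>f\<in>Arr C. \<forall>x\<in>sobj X (Dom C f). t (Cod C f) (sarr X f x) = sarr Y f (t (Dom C f) x)}"

text \<open>Vertical composition ``v after t'' of transformations out of \<open>X\<close>.\<close>

definition set_vcomp ::
  "('o, 'a) cat \<Rightarrow> ('o, 'a, 'x) setfun \<Rightarrow> ('o \<Rightarrow> 'y \<Rightarrow> 'z) \<Rightarrow> ('o \<Rightarrow> 'x \<Rightarrow> 'y) \<Rightarrow> 'o \<Rightarrow> 'x \<Rightarrow> 'z" where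
  "set_vcomp C X v t = (\<lambda>c\<in>Obj C. \<lambda>x\<in>sobj X c. v c (t c x))"

text \<open>Precomposition with \<open>F\<close>, on objects and on morphisms of the functor category.\<close>

definition precomp ::
  "('o, 'a) cat \<Rightarrow> ('o, 'a, 'p, 'b) func \<Rightarrow> ('p, 'b, 'x) setfun \<Rightarrow> ('o, 'a, 'x) setfun" where
  "precomp C F Y =
     \<lparr>sobj = (\<lambda>c\<in>Obj C. sobj Y (fobj F c)), sarr = (\<lambda>f\<in>Arr C. sarr Y (farr F f))\<rparr>"

definition whisker ::
  "('o, 'a) cat \<Rightarrow> ('o, 'a, 'p, 'b) func \<Rightarrow> ('p \<Rightarrow> 'x \<Rightarrow> 'y) \<Rightarrow> 'o \<Rightarrow> 'x \<Rightarrow> 'y" where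
  "whisker C F d = (\<lambda>c\<in>Obj C. d (fobj F c))"


section \<open>Right Kan extensions\<close>

text \<open>\<open>(R, e)\<close> is a value at \<open>X\<close> of the right adjoint of precomposition with \<open>F\<close>, where
  \<open>e : R F \<Rightarrow> X\<close> is the component of the counit: every \<open>g : Z F \<Rightarrow> X\<close> factors through \<open>e\<close> by a unique
  \<open>d : Z \<Rightarrow> R\<close>. Here \<open>Z\<close> ranges over the set-valued functors with the same value type as \<open>R\<close>. The
  pointwise limit construction below satisfies this, with \<open>Z\<close> of any value type.\<close>

definition right_kan_extension ::
  "('o, 'a) cat \<Rightarrow> ('p, 'b) cat \<Rightarrow> ('o, 'a, 'p, 'b) func \<Rightarrow> ('o, 'a, 'x) setfun
     \<Rightarrow> ('p, 'b, 'y) setfun \<Rightarrow> ('o \<Rightarrow> 'y \<Rightarrow> 'x) \<Rightarrow> bool" where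
  "right_kan_extension C D F X R e \<longleftrightarrow>
     set_functor D R \<and> e \<in> set_nat C (precomp C F R) X \<and>
     (\<forall>Z :: ('p, 'b, 'y) setfun. set_functor D Z \<longrightarrow>
        (\<forall>g \<in> set_nat C (precomp C F Z) X.
           \<exists>!d. d \<in> set_nat D Z R \<and> set_vcomp C (precomp C F Z) e (whisker C F d) = g))"

text \<open>The action of the right adjoint on a transformation \<open>t : X \<Rightarrow> X'\<close>, for right Kan extensions
  \<open>(R, e)\<close> of \<open>X\<close> and \<open>(R', e')\<close> of \<open>X'\<close>.\<close>

definition ran_map ::
  "('o, 'a) cat \<Rightarrow> ('p, 'b) cat \<Rightarrow> ('o, 'a, 'p, 'b) func
     \<Rightarrow> ('p, 'b, 'y) setfun \<Rightarrow> ('o \<Rightarrow> 'y \<Rightarrow> 'x) \<Rightarrow> ('p, 'b, 'y) setfun \<Rightarrow> ('o \<Rightarrow> 'y \<Rightarrow> 'x)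
     \<Rightarrow> ('o \<Rightarrow> 'x \<Rightarrow> 'x) \<Rightarrow> 'p \<Rightarrow> 'y \<Rightarrow> 'y" where
  "ran_map C D F R e R' e' t =
     (THE d. d \<in> set_nat D R R' \<and>
        set_vcomp C (precomp C F R) e' (whisker C F d) = set_vcomp C (precomp C F R) t e)"

text \<open>The pointwise formula: objects of the comma category \<open>(d \<down> F)\<close> are pairs \<open>(c, u)\<close> with
  \<open>u : d \<rightarrow> F c\<close>, its morphisms \<open>(c, u) \<rightarrow> (c', F h u)\<close> are the \<open>h : c \<rightarrow> c'\<close>, and the limit is the set of
  compatible families. A morphism \<open>f : d \<rightarrow> d'\<close> reindexes families along precomposition with \<open>f\<close>.\<close>

definition comma_obj ::
  "('o, 'a) cat \<Rightarrow> ('p, 'b) cat \<Rightarrow> ('o, 'a, 'p, 'b) func \<Rightarrow> 'p \<Rightarrow> ('o \<times> 'b) set" where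
  "comma_obj C D F d = {(c, u). c \<in> Obj C \<and> u \<in> Arr D \<and> Dom D u = d \<and> Cod D u = fobj F c}"

definition pointwise_ran ::
  "('o, 'a) cat \<Rightarrow> ('p, 'b) cat \<Rightarrow> ('o, 'a, 'p, 'b) func \<Rightarrow> ('o, 'a, 'x) setfun
     \<Rightarrow> ('p, 'b, 'o \<times> 'b \<Rightarrow> 'x) setfun" where
  "pointwise_ran C D F X =
     (let L = (\<lambda>d. {p \<in> (\<Pi>\<^sub>E (c, u)\<in>comma_obj C D F d. sobj X c).
                 \<forall>(c, u)\<in>comma_obj C D F d. \<forall>h\<in>Arr C. Dom C h = c \<longrightarrow>
                   sarr X h (p (c, u)) = p (Cod C h, Comp D (farr F h) u)})
      in \<lparr>sobj = (\<lambda>d\<in>Obj D. L d),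
          sarr = (\<lambda>f\<in>Arr D. \<lambda>p\<in>L (Dom D f).
                    \<lambda>(c, u)\<in>comma_obj C D F (Cod D f). p (c, Comp D u f))\<rparr>)"

definition pointwise_counit ::
  "('o, 'a) cat \<Rightarrow> ('p, 'b) cat \<Rightarrow> ('o, 'a, 'p, 'b) func \<Rightarrow> ('o, 'a, 'x) setfun
     \<Rightarrow> 'o \<Rightarrow> ('o \<times> 'b \<Rightarrow> 'x) \<Rightarrow> 'x" where
  "pointwise_counit C D F X =
     (\<lambda>c\<in>Obj C. \<lambda>p\<in>sobj (pointwise_ran C D F X) (fobj F c). p (c, Ident D (fobj F c)))"


section \<open>Categories of elements and their sections\<close>

text \<open>A morphism \<open>(c, x) \<rightarrow> (d, y)\<close> of the category of elements is encoded as the triple of its source,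
  the underlying morphism \<open>f : c \<rightarrow> d\<close>, and its target.\<close>

type_synonym ('o, 'a, 'x) el_arr = "('o \<times> 'x) \<times> 'a \<times> ('o \<times> 'x)"

definition elements ::
  "('o, 'a) cat \<Rightarrow> ('o, 'a, 'x) setfun \<Rightarrow> ('o \<times> 'x, ('o, 'a, 'x) el_arr) cat" where
  "elements C X =
     \<lparr>Obj = {(c, x). c \<in> Obj C \<and> x \<in> sobj X c},
      Arr = {((c, x), f, (d, y)). f \<in> Arr C \<and> Dom C f = c \<and> Cod C f = d \<and>
               x \<in> sobj X c \<and> y \<in> sobj X d \<and> sarr X f x = y},
      Dom = (\<lambda>(p, f, q). p),
      Cod = (\<lambda>(p, f, q). q),
      Ident = (\<lambda>(c, x). ((c, x), Ident C c, (c, x))),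
      Comp = (\<lambda>(q, g, r) (p, f, q'). (p, Comp C g f, r))\<rparr>"

definition el_proj ::
  "('o, 'a) cat \<Rightarrow> ('o, 'a, 'x) setfun \<Rightarrow> ('o \<times> 'x, ('o, 'a, 'x) el_arr, 'o, 'a) func" where
  "el_proj C X =
     \<lparr>fobj = (\<lambda>(c, x)\<in>Obj (elements C X). c), farr = (\<lambda>(p, f, q)\<in>Arr (elements C X). f)\<rparr>"

lemma category_elements:
  assumes "category C" "set_functor C X"
  shows "category (elements C X)"
  using assms unfolding category_def set_functor_def elements_def by auto

lemma is_functor_el_proj:
  assumes "category C" "set_functor C X"
  shows "is_functor (elements C X) C (el_proj C X)"
  using assms unfolding category_def set_functor_def is_functor_def elements_def el_proj_def by auto

definition Sect ::
  "('e, 'g) cat \<Rightarrow> ('o, 'a) cat \<Rightarrow> ('e, 'g, 'o, 'a) func \<Rightarrow> ('o, 'a, 'e, 'g) func set" where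
  "Sect E B P = {s. is_functor B E s \<and> comp_functor B P s = id_functor B}"

text \<open>A transformation \<open>t : X \<Rightarrow> Y\<close> induces a functor between the categories of elements over \<open>C\<close>,
  and postcomposition with it maps sections to sections.\<close>

definition el_map ::
  "('o, 'a) cat \<Rightarrow> ('o, 'a, 'x) setfun \<Rightarrow> ('o \<Rightarrow> 'x \<Rightarrow> 'y)
     \<Rightarrow> ('o \<times> 'x, ('o, 'a, 'x) el_arr, 'o \<times> 'y, ('o, 'a, 'y) el_arr) func" where
  "el_map C X t =
     \<lparr>fobj = (\<lambda>(c, x)\<in>Obj (elements C X). (c, t c x)),
      farr = (\<lambda>((c, x), f, (d, y))\<in>Arr (elements C X). ((c, t c x), f, (d, t d y)))\<rparr>"

definition sect_map ::
  "('o, 'a) cat \<Rightarrow> ('o, 'a, 'x) setfun \<Rightarrow> ('o \<Rightarrow> 'x \<Rightarrow> 'y)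
     \<Rightarrow> ('o, 'a, 'o \<times> 'x, ('o, 'a, 'x) el_arr) func
     \<Rightarrow> ('o, 'a, 'o \<times> 'y, ('o, 'a, 'y) el_arr) func" where
  "sect_map C X t s = comp_functor C (el_map C X t) s"


section \<open>Directed sectional category\<close>

definition subcategory :: "('o, 'a) cat \<Rightarrow> ('o, 'a) cat \<Rightarrow> bool" where
  "subcategory U B \<longleftrightarrow> category U \<and> Obj U \<subseteq> Obj B \<and> Arr U \<subseteq> Arr B \<and>
     (\<forall>f\<in>Arr U. Dom U f = Dom B f \<and> Cod U f = Cod B f) \<and>
     (\<forall>c\<in>Obj U. Ident U c = Ident B c) \<and>
     (\<forall>f\<in>Arr U. \<forall>g\<in>Arr U. Cod U f = Dom U g \<longrightarrow> Comp U g f = Comp B g f)"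

definition is_cover :: "('o, 'a) cat \<Rightarrow> nat set \<Rightarrow> (nat \<Rightarrow> ('o, 'a) cat) \<Rightarrow> bool" where
  "is_cover B I U \<longleftrightarrow> (\<forall>i\<in>I. subcategory (U i) B) \<and> (\<forall>f\<in>Arr B. \<exists>i\<in>I. f \<in> Arr (U i))"

text \<open>In the naturality condition \<open>id_functor (U i)\<close>, read as a functor into \<open>B\<close>, is the inclusion of
  the subcategory. The infimum of the empty set is \<open>\<infinity>\<close>.\<close>

definition dsecat ::
  "('e, 'g) cat \<Rightarrow> ('o, 'a) cat \<Rightarrow> ('e, 'g, 'o, 'a) func \<Rightarrow> enat" where
  "dsecat E B P = Inf {enat n | n. \<exists>U. is_cover B {0..n} U \<and>
     (\<forall>i\<in>{0..n}. \<exists>s t. is_functor (U i) E s \<and>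
        nat_trans (U i) B (comp_functor (U i) P s) (id_functor (U i)) t)}"


section \<open>Existence of right Kan extensions\<close>

lemma sobj_pointwise_ran:
  assumes "d \<in> Obj D"
  shows "p \<in> sobj (pointwise_ran C D F X) d \<longleftrightarrow>
     p \<in> extensional (comma_obj C D F d) \<and>
     (\<forall>c u. (c, u) \<in> comma_obj C D F d \<longrightarrow> p (c, u) \<in> sobj X c \<and>
        (\<forall>h\<in>Arr C. Dom C h = c \<longrightarrow>
           sarr X h (p (c, u)) = p (Cod C h, Comp D (farr F h) u)))"
  using assms by (fastforce simp: pointwise_ran_def Let_def PiE_iff)

lemma sarr_pointwise_ran:
  assumes "category D" "f \<in> Arr D"
  shows "sarr (pointwise_ran C D F X) f =
     (\<lambda>p\<in>sobj (pointwise_ran C D F X) (Dom D f).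
        \<lambda>(c, u)\<in>comma_obj C D F (Cod D f). p (c, Comp D u f))"
  using assms by (simp add: pointwise_ran_def Let_def category_def)

context
  fixes C :: "('o, 'a) cat" and D :: "('p, 'b) cat" and F :: "('o, 'a, 'p, 'b) func"
    and X :: "('o, 'a, 'x) setfun"
  assumes C: "category C" and D: "category D" and F: "is_functor C D F" and X: "set_functor C X"
begin

lemma ran_catD:
  "f \<in> Arr D \<Longrightarrow> Dom D f \<in> Obj D" "f \<in> Arr D \<Longrightarrow> Cod D f \<in> Obj D"
  "d \<in> Obj D \<Longrightarrow> Ident D d \<in> Arr D" "d \<in> Obj D \<Longrightarrow> Dom D (Ident D d) = d"
  "d \<in> Obj D \<Longrightarrow> Cod D (Ident D d) = d"
  "f \<in> Arr D \<Longrightarrow> g \<in> Arr D \<Longrightarrow> Cod D f = Dom D g \<Longrightarrow> Comp D g f \<in> Arr D"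
  "f \<in> Arr D \<Longrightarrow> g \<in> Arr D \<Longrightarrow> Cod D f = Dom D g \<Longrightarrow> Dom D (Comp D g f) = Dom D f"
  "f \<in> Arr D \<Longrightarrow> g \<in> Arr D \<Longrightarrow> Cod D f = Dom D g \<Longrightarrow> Cod D (Comp D g f) = Cod D g"
  "f \<in> Arr D \<Longrightarrow> Dom D f = d \<Longrightarrow> Comp D f (Ident D d) = f"
  "f \<in> Arr D \<Longrightarrow> Cod D f = d \<Longrightarrow> Comp D (Ident D d) f = f"
  "f \<in> Arr D \<Longrightarrow> g \<in> Arr D \<Longrightarrow> h \<in> Arr D \<Longrightarrow> Cod D f = Dom D g \<Longrightarrow> Cod D g = Dom D h \<Longrightarrow>
     Comp D h (Comp D g f) = Comp D (Comp D h g) f"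
  using D unfolding category_def by blast+

lemma ran_catC:
  "f \<in> Arr C \<Longrightarrow> Dom C f \<in> Obj C" "f \<in> Arr C \<Longrightarrow> Cod C f \<in> Obj C"
  using C unfolding category_def by blast+

lemma ran_funD:
  "c \<in> Obj C \<Longrightarrow> fobj F c \<in> Obj D" "f \<in> Arr C \<Longrightarrow> farr F f \<in> Arr D"
  "f \<in> Arr C \<Longrightarrow> Dom D (farr F f) = fobj F (Dom C f)"
  "f \<in> Arr C \<Longrightarrow> Cod D (farr F f) = fobj F (Cod C f)"
  using F unfolding is_functor_def by auto

lemma comma_post:
  assumes "(c, u) \<in> comma_obj C D F d" "h \<in> Arr C" "Dom C h = c"
  shows "(Cod C h, Comp D (farr F h) u) \<in> comma_obj C D F d"
  using assms ran_catD ran_funD ran_catC by (auto simp: comma_obj_def)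

lemma comma_pre:
  assumes "(c, u) \<in> comma_obj C D F (Cod D f)" "f \<in> Arr D"
  shows "(c, Comp D u f) \<in> comma_obj C D F (Dom D f)"
  using assms ran_catD by (auto simp: comma_obj_def)

lemma sarr_pointwise_ran_in:
  assumes f: "f \<in> Arr D" and p: "p \<in> sobj (pointwise_ran C D F X) (Dom D f)"
  shows "(\<lambda>(c, u)\<in>comma_obj C D F (Cod D f). p (c, Comp D u f))
           \<in> sobj (pointwise_ran C D F X) (Cod D f)"
proof -
  have p': "p (c, v) \<in> sobj X c" "\<And>h. h \<in> Arr C \<Longrightarrow> Dom C h = c \<Longrightarrow>
      sarr X h (p (c, v)) = p (Cod C h, Comp D (farr F h) v)"
    if "(c, v) \<in> comma_obj C D F (Dom D f)" for c v
    using p that f by (auto simp: sobj_pointwise_ran ran_catD)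
  have "Comp D (farr F h) (Comp D u f) = Comp D (Comp D (farr F h) u) f"
    if "(c, u) \<in> comma_obj C D F (Cod D f)" "h \<in> Arr C" "Dom C h = c" for c u h
    using that f by (intro ran_catD) (auto simp: comma_obj_def ran_funD)
  then show ?thesis
    using f p' comma_pre comma_post
    by (auto simp: sobj_pointwise_ran ran_catD)
qed

lemma set_functor_pointwise_ran: "set_functor D (pointwise_ran C D F X)"
  unfolding set_functor_def
proof (intro conjI ballI impI)
  let ?R = "pointwise_ran C D F X"
  show "sobj ?R \<in> extensional (Obj D)" "sarr ?R \<in> extensional (Arr D)"
    by (auto simp: pointwise_ran_def Let_def)
  show "sarr ?R f \<in> sobj ?R (Dom D f) \<rightarrow>\<^sub>E sobj ?R (Cod D f)" if "f \<in> Arr D" for f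
    using sarr_pointwise_ran_in[OF that] that by (auto simp: sarr_pointwise_ran[OF D])
  show "sarr ?R (Ident D d) p = p" if "d \<in> Obj D" "p \<in> sobj ?R d" for d p
  proof -
    have "p (c, Comp D u (Ident D d)) = p (c, u)" if "(c, u) \<in> comma_obj C D F d" for c u
      using that by (auto simp: comma_obj_def ran_catD)
    moreover have "p \<in> extensional (comma_obj C D F d)"
      using that by (auto simp: sobj_pointwise_ran)
    ultimately show ?thesis
      using that by (auto simp: sarr_pointwise_ran[OF D] ran_catD extensional_def fun_eq_iff)
  qed
  show "sarr ?R (Comp D g f) p = sarr ?R g (sarr ?R f p)"
    if "f \<in> Arr D" "g \<in> Arr D" "Cod D f = Dom D g" "p \<in> sobj ?R (Dom D f)" for f g p
  proof -
    have "p (c, Comp D u (Comp D g f)) = p (c, Comp D (Comp D u g) f)"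
      if "(c, u) \<in> comma_obj C D F (Cod D g)" for c u
      using that \<open>f \<in> Arr D\<close> \<open>g \<in> Arr D\<close> \<open>Cod D f = Dom D g\<close>
      by (auto simp: comma_obj_def ran_catD)
    then show ?thesis
      using that sarr_pointwise_ran_in[of f p] comma_pre[of _ _ g]
      by (auto simp: sarr_pointwise_ran[OF D] ran_catD fun_eq_iff)
  qed
qed

lemma comma_ident: "c \<in> Obj C \<Longrightarrow> (c, Ident D (fobj F c)) \<in> comma_obj C D F (fobj F c)"
  by (auto simp: comma_obj_def ran_funD ran_catD)

lemma pointwise_counit_nat:
  "pointwise_counit C D F X \<in> set_nat C (precomp C F (pointwise_ran C D F X)) X"
proof -
  let ?R = "pointwise_ran C D F X" and ?e = "pointwise_counit C D F X"
  have "?e c p \<in> sobj X c" if "c \<in> Obj C" "p \<in> sobj ?R (fobj F c)" for c p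
    using that comma_ident[OF that(1)]
    by (auto simp: pointwise_counit_def sobj_pointwise_ran ran_funD)
  moreover have "?e (Cod C f) (sarr ?R (farr F f) p) = sarr X f (?e (Dom C f) p)"
    if f: "f \<in> Arr C" and p: "p \<in> sobj ?R (fobj F (Dom C f))" for f p
  proof -
    have q: "sarr ?R (farr F f) p \<in> sobj ?R (fobj F (Cod C f))"
      using sarr_pointwise_ran_in[of "farr F f" p] f p
      by (simp add: sarr_pointwise_ran[OF D] ran_funD)
    have "sarr X f (p (Dom C f, Ident D (fobj F (Dom C f)))) =
        p (Cod C f, Comp D (farr F f) (Ident D (fobj F (Dom C f))))"
      using p f comma_ident[of "Dom C f"] by (auto simp: sobj_pointwise_ran ran_funD ran_catC)
    also have "\<dots> = p (Cod C f, Comp D (Ident D (fobj F (Cod C f))) (farr F f))"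
      using f by (simp add: ran_catD ran_funD)
    also have "\<dots> = sarr ?R (farr F f) p (Cod C f, Ident D (fobj F (Cod C f)))"
      using f p comma_ident[of "Cod C f"] by (simp add: sarr_pointwise_ran[OF D] ran_funD ran_catC)
    finally show ?thesis
      using f p q by (simp add: pointwise_counit_def ran_catC)
  qed
  ultimately show ?thesis
    by (auto simp: set_nat_def precomp_def ran_catC pointwise_counit_def)
qed

lemma pointwise_ran_universal:
  fixes Z :: "('p, 'b, 'z) setfun"
  assumes Z: "set_functor D Z" and g: "g \<in> set_nat C (precomp C F Z) X"
  shows "\<exists>!d. d \<in> set_nat D Z (pointwise_ran C D F X) \<and>
           set_vcomp C (precomp C F Z) (pointwise_counit C D F X) (whisker C F d) = g"
proof -
  let ?R = "pointwise_ran C D F X" and ?e = "pointwise_counit C D F X"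
  let ?d = "\<lambda>d\<in>Obj D. \<lambda>z\<in>sobj Z d. \<lambda>(c, u)\<in>comma_obj C D F d. g c (sarr Z u z)"
  have Zin: "sarr Z f z \<in> sobj Z (Cod D f)" if "f \<in> Arr D" "z \<in> sobj Z (Dom D f)" for f z
    using Z that by (auto simp: set_functor_def)
  have Zcomp: "sarr Z (Comp D h f) z = sarr Z h (sarr Z f z)"
    if "f \<in> Arr D" "h \<in> Arr D" "Cod D f = Dom D h" "z \<in> sobj Z (Dom D f)" for f h z
    using Z that by (auto simp: set_functor_def)
  have gin: "g c z \<in> sobj X c" if "c \<in> Obj C" "z \<in> sobj Z (fobj F c)" for c z
    using g that by (fastforce simp: set_nat_def precomp_def)
  have gnat: "g (Cod C f) (sarr Z (farr F f) z) = sarr X f (g (Dom C f) z)"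
    if "f \<in> Arr C" "z \<in> sobj Z (fobj F (Dom C f))" for f z
    using g that by (auto simp: set_nat_def precomp_def ran_catC)
  have din: "?d d z \<in> sobj ?R d" if dz: "d \<in> Obj D" "z \<in> sobj Z d" for d z
  proof -
    have "g c (sarr Z u z) \<in> sobj X c" if "(c, u) \<in> comma_obj C D F d" for c u
      using that dz gin Zin by (force simp: comma_obj_def)
    moreover have "sarr X h (g c (sarr Z u z)) = g (Cod C h) (sarr Z (Comp D (farr F h) u) z)"
      if "(c, u) \<in> comma_obj C D F d" "h \<in> Arr C" "Dom C h = c" for c u h
      using that dz Zin[of u z] gnat[of h "sarr Z u z"] Zcomp[of u "farr F h" z]
      by (auto simp: comma_obj_def ran_funD)
    ultimately show ?thesis
      using dz comma_post by (auto simp: sobj_pointwise_ran)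
  qed
  have dnat: "?d \<in> set_nat D Z ?R"
  proof -
    have "?d (Cod D f) (sarr Z f z) = sarr ?R f (?d (Dom D f) z)"
      if f: "f \<in> Arr D" and z: "z \<in> sobj Z (Dom D f)" for f z
    proof -
      have "g c (sarr Z u (sarr Z f z)) = g c (sarr Z (Comp D u f) z)"
        if "(c, u) \<in> comma_obj C D F (Cod D f)" for c u
        using that f z Zcomp by (auto simp: comma_obj_def)
      then show ?thesis
        using f z din[of "Dom D f" z] Zin[OF f z] comma_pre
        by (auto simp: sarr_pointwise_ran[OF D] ran_catD fun_eq_iff)
    qed
    then show ?thesis
      using din by (auto simp: set_nat_def)
  qed
  have dg: "set_vcomp C (precomp C F Z) ?e (whisker C F ?d) = g"
  proof (intro ext)
    fix c z
    have ext: "g \<in> extensional (Obj C)"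
      "c \<in> Obj C \<Longrightarrow> g c \<in> extensional (sobj Z (fobj F c))"
      using g by (auto simp: set_nat_def precomp_def PiE_def Pi_def)
    have "?e c (?d (fobj F c) z) = g c z" if "c \<in> Obj C" "z \<in> sobj Z (fobj F c)"
      using that din[of "fobj F c" z] comma_ident[of c] Z
      by (auto simp: pointwise_counit_def ran_funD set_functor_def)
    then show "set_vcomp C (precomp C F Z) ?e (whisker C F ?d) c z = g c z"
      using ext by (auto simp: set_vcomp_def whisker_def precomp_def extensional_def)
  qed
  have "d = ?d" if d: "d \<in> set_nat D Z ?R"
    and eq: "set_vcomp C (precomp C F Z) ?e (whisker C F d) = g" for d
  proof (intro ext)
    fix a z w
    have din': "d a z \<in> sobj ?R a" if "a \<in> Obj D" "z \<in> sobj Z a" for a z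
      using d that by (force simp: set_nat_def)
    have dcomp: "d a z (c, u) = g c (sarr Z u z)"
      if a: "a \<in> Obj D" and z: "z \<in> sobj Z a" and cu: "(c, u) \<in> comma_obj C D F a" for c u
    proof -
      have u: "u \<in> Arr D" "Dom D u = a" "Cod D u = fobj F c" "c \<in> Obj C"
        using cu by (auto simp: comma_obj_def)
      have zu: "sarr Z u z \<in> sobj Z (fobj F c)"
        using Zin[of u z] u z by simp
      have "g c (sarr Z u z) = d (fobj F c) (sarr Z u z) (c, Ident D (fobj F c))"
        using u zu din'[of "fobj F c" "sarr Z u z"]
        by (simp add: eq[symmetric] set_vcomp_def whisker_def precomp_def pointwise_counit_def ran_funD)
      also have "d (fobj F c) (sarr Z u z) = sarr ?R u (d a z)"
        using d u z by (auto simp: set_nat_def)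
      also have "\<dots> (c, Ident D (fobj F c)) = d a z (c, Comp D (Ident D (fobj F c)) u)"
        using u din'[OF a z] comma_ident[of c] by (simp add: sarr_pointwise_ran[OF D])
      also have "\<dots> = d a z (c, u)"
        using u by (simp add: ran_catD)
      finally show ?thesis ..
    qed
    have "d \<in> extensional (Obj D)" "a \<in> Obj D \<Longrightarrow> d a \<in> extensional (sobj Z a)"
      using d by (auto simp: set_nat_def PiE_def Pi_def)
    moreover have "d a z \<in> extensional (comma_obj C D F a)" if "a \<in> Obj D" "z \<in> sobj Z a"
      using din'[OF that] that by (auto simp: sobj_pointwise_ran)
    ultimately show "d a z w = ?d a z w"
      using dcomp by (cases w) (auto simp: extensional_def)
  qed
  with dnat dg show ?thesis by blast
qed

theorem right_kan_extension_pointwise_ran: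
  "right_kan_extension C D F X (pointwise_ran C D F X) (pointwise_counit C D F X)"
  unfolding right_kan_extension_def
  using set_functor_pointwise_ran pointwise_counit_nat pointwise_ran_universal by blast

end

end

theory Submission
  imports Defs
begin

text \<open>A section of the category of elements of \<open>X\<close> is the same thing as an element of \<open>lim X\<close>, that
  is, a transformation \<open>1 \<Rightarrow> X\<close> from the constant singleton functor. Since \<open>1\<close> is stable under
  precomposition with \<open>F\<close>, the universal property of the right Kan extension \<open>(R, e)\<close>, applied to
  \<open>Z = 1\<close>, says that evaluation along \<open>e\<close> is a bijection \<open>lim R \<rightarrow> lim X\<close>. For the last claim, a
  cover by a single subcategory is all of the base, and \<open>t : P s \<Rightarrow> \<iota>\<close> turns a functor \<open>s\<close> into the
  compatible family \<open>c \<mapsto> X (t c) (s c)\<close>; hence \<open>dsecat\<close> vanishes exactly if a section exists.\<close>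

section \<open>Sections as compatible families\<close>

lemma catD:
  assumes "category C"
  shows "f \<in> Arr C \<Longrightarrow> Dom C f \<in> Obj C" "f \<in> Arr C \<Longrightarrow> Cod C f \<in> Obj C"
    "c \<in> Obj C \<Longrightarrow> Ident C c \<in> Arr C" "c \<in> Obj C \<Longrightarrow> Dom C (Ident C c) = c"
    "c \<in> Obj C \<Longrightarrow> Cod C (Ident C c) = c"
    "f \<in> Arr C \<Longrightarrow> g \<in> Arr C \<Longrightarrow> Cod C f = Dom C g \<Longrightarrow> Comp C g f \<in> Arr C"
    "f \<in> Arr C \<Longrightarrow> g \<in> Arr C \<Longrightarrow> Cod C f = Dom C g \<Longrightarrow> Dom C (Comp C g f) = Dom C f"
    "f \<in> Arr C \<Longrightarrow> g \<in> Arr C \<Longrightarrow> Cod C f = Dom C g \<Longrightarrow> Cod C (Comp C g f) = Cod C g"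
    "f \<in> Arr C \<Longrightarrow> Comp C f (Ident C (Dom C f)) = f"
    "f \<in> Arr C \<Longrightarrow> Comp C (Ident C (Cod C f)) f = f"
  using assms unfolding category_def by blast+

lemma set_functorD:
  assumes "set_functor C X"
  shows "f \<in> Arr C \<Longrightarrow> x \<in> sobj X (Dom C f) \<Longrightarrow> sarr X f x \<in> sobj X (Cod C f)"
    "c \<in> Obj C \<Longrightarrow> x \<in> sobj X c \<Longrightarrow> sarr X (Ident C c) x = x"
    "f \<in> Arr C \<Longrightarrow> g \<in> Arr C \<Longrightarrow> Cod C f = Dom C g \<Longrightarrow> x \<in> sobj X (Dom C f) \<Longrightarrow>
       sarr X (Comp C g f) x = sarr X g (sarr X f x)"
  using assms unfolding set_functor_def by (auto dest!: bspec PiE_mem)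

text \<open>The limit of \<open>X\<close> in its standard model. Pinning the values off
  \<open>Obj C\<close> to \<open>undefined\<close> makes the passage to sections bijective on the
  nose, since functors are pinned in the same way.\<close>

definition lim_set :: "('o, 'a) cat \<Rightarrow> ('o, 'a, 'x) setfun \<Rightarrow> ('o \<Rightarrow> 'x) set" where
  "lim_set C X =
     {x \<in> (\<Pi>\<^sub>E c\<in>Obj C. sobj X c). \<forall>f\<in>Arr C. sarr X f (x (Dom C f)) = x (Cod C f)}"

definition section_of ::
  "('o, 'a) cat \<Rightarrow> ('o \<Rightarrow> 'x) \<Rightarrow> ('o, 'a, 'o \<times> 'x, ('o, 'a, 'x) el_arr) func" where
  "section_of C x =
     \<lparr>fobj = (\<lambda>c\<in>Obj C. (c, x c)),
      farr = (\<lambda>f\<in>Arr C. ((Dom C f, x (Dom C f)), f, (Cod C f, x (Cod C f))))\<rparr>"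

definition family_of ::
  "('o, 'a) cat \<Rightarrow> ('o, 'a, 'o \<times> 'x, ('o, 'a, 'x) el_arr) func \<Rightarrow> 'o \<Rightarrow> 'x" where
  "family_of C s = (\<lambda>c\<in>Obj C. snd (fobj s c))"

lemma lim_setD:
  assumes "x \<in> lim_set C X"
  shows "c \<in> Obj C \<Longrightarrow> x c \<in> sobj X c"
    "f \<in> Arr C \<Longrightarrow> sarr X f (x (Dom C f)) = x (Cod C f)"
    "x \<in> extensional (Obj C)"
  using assms by (auto simp: lim_set_def PiE_def)

lemma section_of_in_Sect:
  assumes C: "category C" and x: "x \<in> lim_set C X"
  shows "section_of C x \<in> Sect (elements C X) C (el_proj C X)"
proof -
  have "is_functor C (elements C X) (section_of C x)"
    using lim_setD(1,2)[OF x] catD[OF C]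
    by (auto simp: is_functor_def section_of_def elements_def)
  moreover have "comp_functor C (el_proj C X) (section_of C x) = id_functor C"
    using lim_setD(1,2)[OF x] catD[OF C]
    by (auto simp: comp_functor_def id_functor_def el_proj_def section_of_def elements_def
        intro!: restrict_ext)
  ultimately show ?thesis
    by (simp add: Sect_def)
qed

lemma family_of_section_of:
  "x \<in> lim_set C X \<Longrightarrow> family_of C (section_of C x) = x"
  using lim_setD(3)[of x C X]
  by (auto simp: family_of_def section_of_def extensional_def fun_eq_iff)

text \<open>The equation over the base forces the first component of \<open>fobj s c\<close> to be
  \<open>c\<close> and the middle component of \<open>farr s f\<close> to be \<open>f\<close>;
  functoriality fixes source and target. So a section is determined by its object map, and the
  condition that \<open>farr s f\<close> be a morphism is exactly compatibility of the
  family.\<close>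

lemma
  assumes C: "category C" and s: "s \<in> Sect (elements C X) C (el_proj C X)"
  shows family_of_in_lim_set: "family_of C s \<in> lim_set C X"
    and section_of_family_of: "section_of C (family_of C s) = s"
proof -
  have fo: "fobj s \<in> Obj C \<rightarrow>\<^sub>E Obj (elements C X)"
    and fa: "farr s \<in> Arr C \<rightarrow>\<^sub>E Arr (elements C X)"
    and dc: "\<And>f. f \<in> Arr C \<Longrightarrow> Dom (elements C X) (farr s f) = fobj s (Dom C f)"
      "\<And>f. f \<in> Arr C \<Longrightarrow> Cod (elements C X) (farr s f) = fobj s (Cod C f)"
    and id: "comp_functor C (el_proj C X) s = id_functor C"
    using s by (auto simp: Sect_def is_functor_def)
  have obj: "fobj s c = (c, family_of C s c) \<and> family_of C s c \<in> sobj X c" if c: "c \<in> Obj C" for c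
  proof -
    have "fobj s c \<in> Obj (elements C X)"
      using fo c by auto
    moreover have "fobj (el_proj C X) (fobj s c) = c"
      using arg_cong[OF id, of "\<lambda>G. fobj G c"] c by (simp add: comp_functor_def id_functor_def)
    ultimately show ?thesis
      using c by (auto simp: el_proj_def elements_def family_of_def)
  qed
  have arr: "farr s f = (fobj s (Dom C f), f, fobj s (Cod C f)) \<and>
      sarr X f (family_of C s (Dom C f)) = family_of C s (Cod C f)" if f: "f \<in> Arr C" for f
  proof -
    have "farr s f \<in> Arr (elements C X)"
      using fa f by auto
    moreover have "farr (el_proj C X) (farr s f) = f"
      using arg_cong[OF id, of "\<lambda>G. farr G f"] f by (simp add: comp_functor_def id_functor_def)
    ultimately show ?thesis
      using dc[OF f] obj[OF catD(1)[OF C f]] obj[OF catD(2)[OF C f]]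
      by (auto simp: el_proj_def elements_def)
  qed
  show "family_of C s \<in> lim_set C X"
    using obj arr by (auto simp: lim_set_def family_of_def[of C s])
  have "fobj (section_of C (family_of C s)) = fobj s"
    using obj fo by (auto simp: section_of_def fun_eq_iff PiE_def extensional_def)
  moreover have "farr (section_of C (family_of C s)) = farr s"
    using obj arr fa catD(1,2)[OF C]
    by (auto simp: section_of_def fun_eq_iff PiE_def extensional_def)
  ultimately show "section_of C (family_of C s) = s"
    by simp
qed

lemma bij_betw_section_of:
  assumes "category C"
  shows "bij_betw (section_of C) (lim_set C X) (Sect (elements C X) C (el_proj C X))"
  using section_of_in_Sect[OF assms] family_of_in_lim_set[OF assms]
    section_of_family_of[OF assms] family_of_section_of
  by (intro bij_betw_byWitness[where f' = "family_of C"]) blast+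

lemma bij_betw_family_of:
  assumes "category C"
  shows "bij_betw (family_of C) (Sect (elements C X) C (el_proj C X)) (lim_set C X)"
  using section_of_in_Sect[OF assms] family_of_in_lim_set[OF assms]
    section_of_family_of[OF assms] family_of_section_of
  by (intro bij_betw_byWitness[where f' = "section_of C"]) blast+

section \<open>Functoriality of limits in the set-valued functor\<close>

definition lim_map ::
  "('o, 'a) cat \<Rightarrow> ('o \<Rightarrow> 'x \<Rightarrow> 'y) \<Rightarrow> ('o \<Rightarrow> 'x) \<Rightarrow> 'o \<Rightarrow> 'y" where
  "lim_map C t x = (\<lambda>c\<in>Obj C. t c (x c))"

lemma set_natD:
  assumes "t \<in> set_nat C X Y"
  shows "c \<in> Obj C \<Longrightarrow> x \<in> sobj X c \<Longrightarrow> t c x \<in> sobj Y c"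
    "f \<in> Arr C \<Longrightarrow> x \<in> sobj X (Dom C f) \<Longrightarrow> t (Cod C f) (sarr X f x) = sarr Y f (t (Dom C f) x)"
  using assms by (auto simp: set_nat_def dest!: PiE_mem)

lemma lim_map_in_lim_set:
  assumes C: "category C" and t: "t \<in> set_nat C X Y" and x: "x \<in> lim_set C X"
  shows "lim_map C t x \<in> lim_set C Y"
  using set_natD[OF t] lim_setD(1)[OF x] lim_setD(2)[OF x, symmetric] catD(1,2)[OF C]
  by (auto simp: lim_set_def lim_map_def)

text \<open>This lets naturality be checked on families instead of on functors into categories of
  elements.\<close>

lemma sect_map_section_of:
  assumes C: "category C" and x: "x \<in> lim_set C X"
  shows "sect_map C X t (section_of C x) = section_of C (lim_map C t x)"
  using lim_setD(1,2)[OF x] catD(1,2)[OF C]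
  by (auto simp: sect_map_def comp_functor_def el_map_def section_of_def elements_def lim_map_def
      intro!: restrict_ext)

section \<open>Limits of right Kan extensions\<close>

text \<open>The comparison map from \<open>lim R\<close> through \<open>lim (R F)\<close> to
  \<open>lim X\<close>: restriction along \<open>F\<close>, followed by the map that
  \<open>e\<close> induces.\<close>

definition lim_restrict ::
  "('o, 'a) cat \<Rightarrow> ('o, 'a, 'p, 'b) func \<Rightarrow> ('o \<Rightarrow> 'y \<Rightarrow> 'x) \<Rightarrow> ('p \<Rightarrow> 'y) \<Rightarrow> 'o \<Rightarrow> 'x" where
  "lim_restrict C F e r = (\<lambda>c\<in>Obj C. e c (r (fobj F c)))"

text \<open>The terminal set-valued functor. Its one element is \<open>undefined\<close> because
  that term exists in every type: \<open>point D\<close> can thus be formed with the value type of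
  \<open>R\<close>, over which \<open>right_kan_extension\<close> quantifies
  \<open>Z\<close>.\<close>

definition point :: "('p, 'b) cat \<Rightarrow> ('p, 'b, 'y) setfun" where
  "point D = \<lparr>sobj = (\<lambda>d\<in>Obj D. {undefined}), sarr = (\<lambda>f\<in>Arr D. \<lambda>z\<in>{undefined}. z)\<rparr>"

definition point_map :: "('p, 'b) cat \<Rightarrow> ('p \<Rightarrow> 'x) \<Rightarrow> 'p \<Rightarrow> 'y \<Rightarrow> 'x" where
  "point_map D x = (\<lambda>d\<in>Obj D. \<lambda>z\<in>{undefined}. x d)"

lemma set_functor_point:
  assumes "category D"
  shows "set_functor D (point D)"
  using catD[OF assms] by (auto simp: set_functor_def point_def)

text \<open>Naturality at \<open>f\<close> of a transformation out of the terminal functor is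
  compatibility of its values at \<open>f\<close>. The value type of the point is independent of
  that of \<open>Y\<close>, since over \<open>C\<close> a point with values in the type of
  \<open>R\<close> is mapped to \<open>X\<close>.\<close>

lemma bij_betw_point_map:
  fixes Y :: "('p, 'b, 'x) setfun"
  assumes D: "category D"
  shows "bij_betw (point_map D) (lim_set D Y) (set_nat D (point D :: ('p, 'b, 'y) setfun) Y)"
proof (rule bij_betw_byWitness[where f' = "\<lambda>t. \<lambda>d\<in>Obj D. t d undefined"])
  show "\<forall>x\<in>lim_set D Y. (\<lambda>d\<in>Obj D. point_map D x d (undefined :: 'y)) = x"
    using lim_setD(3) by (fastforce simp: point_map_def extensional_def fun_eq_iff)
  show "\<forall>t\<in>set_nat D (point D :: ('p, 'b, 'y) setfun) Y.
      point_map D (\<lambda>d\<in>Obj D. t d undefined) = t"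
  proof (intro ballI ext)
    fix t :: "'p \<Rightarrow> 'y \<Rightarrow> 'x" and d z
    assume t: "t \<in> set_nat D (point D :: ('p, 'b, 'y) setfun) Y"
    have "t \<in> extensional (Obj D)" "d \<in> Obj D \<Longrightarrow> t d \<in> extensional {undefined}"
      using t by (auto simp: set_nat_def point_def PiE_def Pi_def)
    then show "point_map D (\<lambda>d\<in>Obj D. t d undefined) d z = t d z"
      by (auto simp: point_map_def extensional_def)
  qed
  show "point_map D ` lim_set D Y \<subseteq> set_nat D (point D :: ('p, 'b, 'y) setfun) Y"
    using lim_setD(1,2) catD(1,2)[OF D] by (fastforce simp: set_nat_def point_map_def point_def)
  show "(\<lambda>t. \<lambda>d\<in>Obj D. t d undefined) ` set_nat D (point D :: ('p, 'b, 'y) setfun) Y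
      \<subseteq> lim_set D Y"
  proof (intro image_subsetI)
    fix t assume t: "t \<in> set_nat D (point D :: ('p, 'b, 'y) setfun) Y"
    show "(\<lambda>d\<in>Obj D. t d undefined) \<in> lim_set D Y"
      using set_natD(1)[OF t, of _ undefined] set_natD(2)[OF t, of _ undefined] catD(1,2)[OF D]
      by (auto simp: lim_set_def point_def)
  qed
qed

lemma is_functorD:
  assumes "is_functor C D F"
  shows "c \<in> Obj C \<Longrightarrow> fobj F c \<in> Obj D" "f \<in> Arr C \<Longrightarrow> farr F f \<in> Arr D"
    "f \<in> Arr C \<Longrightarrow> Dom D (farr F f) = fobj F (Dom C f)"
    "f \<in> Arr C \<Longrightarrow> Cod D (farr F f) = fobj F (Cod C f)"
  using assms unfolding is_functor_def by auto

text \<open>An equality and not merely an isomorphism, so that the universal property for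
  \<open>Z = point D\<close> speaks literally about \<open>set_nat C (point C) X\<close>.\<close>

lemma precomp_point:
  assumes "is_functor C D F"
  shows "precomp C F (point D) = point C"
  using is_functorD[OF assms] by (auto simp: precomp_def point_def intro!: restrict_ext)

text \<open>Under the identification of families with maps from the point, the adjoint transpose is
  \<open>lim_restrict\<close>.\<close>

lemma set_vcomp_point_map:
  assumes "is_functor C D F"
  shows "set_vcomp C (point C) e (whisker C F (point_map D r)) = point_map C (lim_restrict C F e r)"
  using is_functorD[OF assms]
  by (auto simp: set_vcomp_def whisker_def point_map_def lim_restrict_def point_def fun_eq_iff)

text \<open>The adjunction gives \<open>Hom(1, R)\<close> = \<open>Hom(1 F, X)\<close> =
  \<open>Hom(1, X)\<close>, and the outer terms are the two limits.\<close>

lemma bij_betw_lim_restrict: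
  fixes R :: "('p, 'b, 'y) setfun"
  assumes C: "category C" and D: "category D" and F: "is_functor C D F"
    and ran: "right_kan_extension C D F X R e"
  shows "bij_betw (lim_restrict C F e) (lim_set D R) (lim_set C X)"
proof -
  let ?ZC = "point C :: ('a, 'c, 'y) setfun" and ?ZD = "point D :: ('p, 'b, 'y) setfun"
  let ?\<psi> = "\<lambda>d. set_vcomp C ?ZC e (whisker C F d)"
  have e: "e \<in> set_nat C (precomp C F R) X"
    using ran by (simp add: right_kan_extension_def)
  have restr: "lim_restrict C F e r \<in> lim_set C X" if r: "r \<in> lim_set D R" for r
  proof -
    have "(\<lambda>c\<in>Obj C. r (fobj F c)) \<in> lim_set C (precomp C F R)"
      using lim_setD(1)[OF r] lim_setD(2)[OF r is_functorD(2)[OF F]]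
      by (simp add: lim_set_def precomp_def is_functorD[OF F] catD(1,2)[OF C])
    from lim_map_in_lim_set[OF C e this] show ?thesis
      by (simp add: lim_map_def lim_restrict_def cong: restrict_cong)
  qed
  have univ: "\<exists>!d. d \<in> set_nat D ?ZD R \<and> ?\<psi> d = g" if "g \<in> set_nat C ?ZC X" for g
    using ran that set_functor_point[OF D] precomp_point[OF F]
    unfolding right_kan_extension_def by metis
  have pm: "bij_betw (point_map D) (lim_set D R) (set_nat D ?ZD R)"
    "bij_betw (point_map C) (lim_set C X) (set_nat C ?ZC X)"
    using bij_betw_point_map[OF D] bij_betw_point_map[OF C] by auto
  have "\<exists>!r. r \<in> lim_set D R \<and> lim_restrict C F e r = x" if x: "x \<in> lim_set C X" for x
  proof -
    have "point_map C x \<in> set_nat C ?ZC X"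
      using pm(2) x by (auto simp: bij_betw_def)
    from univ[OF this] obtain d where d: "d \<in> set_nat D ?ZD R" "?\<psi> d = point_map C x"
      and uniq: "\<And>d'. d' \<in> set_nat D ?ZD R \<Longrightarrow> ?\<psi> d' = point_map C x \<Longrightarrow> d' = d"
      by blast
    \<comment> \<open>Injectivity of \<open>point_map C\<close> turns the factorization equation
      between transformations into an equation between families.\<close>
    have iff: "?\<psi> (point_map D r) = point_map C x \<longleftrightarrow> lim_restrict C F e r = x"
      if "r \<in> lim_set D R" for r
      using bij_betw_imp_inj_on[OF pm(2)] restr[OF that] x
      by (auto simp: set_vcomp_point_map[OF F] dest: inj_onD)
    obtain r where r: "r \<in> lim_set D R" "d = point_map D r"
      using pm(1) d(1) by (auto simp: bij_betw_def)
    show ?thesis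
    proof (rule ex1I[of _ r])
      show "r \<in> lim_set D R \<and> lim_restrict C F e r = x"
        using r d iff by blast
      show "r' = r" if r': "r' \<in> lim_set D R \<and> lim_restrict C F e r' = x" for r'
      proof -
        have "point_map D r' = d"
          using r' iff[of r'] uniq[of "point_map D r'"] bij_betw_apply[OF pm(1), of r'] by simp
        then show ?thesis
          using bij_betw_imp_inj_on[OF pm(1)] r' r by (simp add: inj_on_eq_iff)
      qed
    qed
  qed
  with restr show ?thesis
    by (intro bij_betwI') metis+
qed

section \<open>Naturality of the comparison between the two limits\<close>

text \<open>The universal property of \<open>(R', e')\<close> is applied with \<open>Z = R\<close>,
  which is admissible because \<open>R\<close> and \<open>R'\<close> share a value type. Unique
  existence then justifies the \<open>THE\<close> in \<open>ran_map\<close>.\<close>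

lemma
  assumes C: "category C" and F: "is_functor C D F"
    and ran: "right_kan_extension C D F X R e" and ran': "right_kan_extension C D F X' R' e'"
    and t: "t \<in> set_nat C X X'"
  shows ran_map_in_set_nat: "ran_map C D F R e R' e' t \<in> set_nat D R R'"
    and ran_map_counit: "set_vcomp C (precomp C F R) e' (whisker C F (ran_map C D F R e R' e' t)) =
      set_vcomp C (precomp C F R) t e"
proof -
  have e: "e \<in> set_nat C (precomp C F R) X" and R: "set_functor D R"
    using ran by (auto simp: right_kan_extension_def)
  have "sarr (precomp C F R) f x \<in> sobj (precomp C F R) (Cod C f)"
    if "f \<in> Arr C" "x \<in> sobj (precomp C F R) (Dom C f)" for f x
    using that set_functorD(1)[OF R, of "farr F f"] is_functorD[OF F] catD(1,2)[OF C]
    by (auto simp: precomp_def)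
  then have "set_vcomp C (precomp C F R) t e \<in> set_nat C (precomp C F R) X'"
    using set_natD[OF t] set_natD[OF e] catD(1,2)[OF C]
    by (auto simp: set_nat_def[of _ _ X'] set_vcomp_def)
  with ran' R have "\<exists>!d. d \<in> set_nat D R R' \<and>
      set_vcomp C (precomp C F R) e' (whisker C F d) = set_vcomp C (precomp C F R) t e"
    unfolding right_kan_extension_def by blast
  from theI'[OF this]
  show "ran_map C D F R e R' e' t \<in> set_nat D R R'"
    "set_vcomp C (precomp C F R) e' (whisker C F (ran_map C D F R e R' e' t)) =
      set_vcomp C (precomp C F R) t e"
    unfolding ran_map_def by blast+
qed

text \<open>The equation defining \<open>ran_map\<close>, evaluated at the element
  \<open>r (fobj F c)\<close>.\<close>

lemma lim_restrict_ran_map: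
  assumes C: "category C" and F: "is_functor C D F"
    and ran: "right_kan_extension C D F X R e" and ran': "right_kan_extension C D F X' R' e'"
    and t: "t \<in> set_nat C X X'" and r: "r \<in> lim_set D R"
  shows "lim_restrict C F e' (lim_map D (ran_map C D F R e R' e' t) r) =
    lim_map C t (lim_restrict C F e r)"
proof
  fix c
  show "lim_restrict C F e' (lim_map D (ran_map C D F R e R' e' t) r) c =
    lim_map C t (lim_restrict C F e r) c"
    using fun_cong[OF fun_cong[OF ran_map_counit[OF C F ran ran' t]], of c "r (fobj F c)"]
      lim_setD(1)[OF r, of "fobj F c"] is_functorD(1)[OF F, of c]
    by (auto simp: lim_restrict_def lim_map_def set_vcomp_def whisker_def precomp_def)
qed

section \<open>Directed sectional category zero\<close>

lemma Inf_enat_eq_0_iff: "Inf S = 0 \<longleftrightarrow> 0 \<in> S" for S :: "enat set"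
proof
  assume "Inf S = 0"
  then have "S \<noteq> {}" and "(LEAST n. n \<in> S) = 0"
    by (auto simp: Inf_enat_def split: if_splits)
  then show "0 \<in> S"
    using LeastI_ex[of "\<lambda>n. n \<in> S"] by auto
next
  assume "0 \<in> S"
  then have "Inf S \<le> 0"
    by (rule Inf_lower)
  then show "Inf S = 0"
    by simp
qed

text \<open>Infima in \<open>enat\<close> of nonempty sets are attained, so the value 0 means that
  \<open>n = 0\<close> itself works; the index set \<open>{0..0}\<close> leaves a single
  subcategory.\<close>

lemma dsecat_eq_0_iff:
  "dsecat E B P = 0 \<longleftrightarrow> (\<exists>U s t. subcategory U B \<and> Arr B \<subseteq> Arr U \<and> is_functor U E s \<and>
     nat_trans U B (comp_functor U P s) (id_functor U) t)" (is "_ \<longleftrightarrow> ?rhs")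
proof -
  let ?Q = "\<lambda>n. \<exists>U. is_cover B {0..n} U \<and> (\<forall>i\<in>{0..n}. \<exists>s t. is_functor (U i) E s \<and>
        nat_trans (U i) B (comp_functor (U i) P s) (id_functor (U i)) t)"
  let ?S = "{enat n | n. ?Q n}"
  have "dsecat E B P = 0 \<longleftrightarrow> 0 \<in> ?S"
    unfolding dsecat_def by (rule Inf_enat_eq_0_iff)
  also have "\<dots> \<longleftrightarrow> ?Q 0"
    by (auto simp: zero_enat_def)
  also have "\<dots> \<longleftrightarrow> ?rhs"
  proof
    assume ?rhs
    then obtain U s t where "subcategory U B \<and> Arr B \<subseteq> Arr U \<and> is_functor U E s \<and>
      nat_trans U B (comp_functor U P s) (id_functor U) t" by blast
    then show "?Q 0"
      by (intro exI[of _ "\<lambda>_. U"]) (auto simp: is_cover_def)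
  qed (auto simp: is_cover_def)
  finally show ?thesis .
qed

text \<open>A strict section qualifies with identities as transformation. Conversely,
  \<open>t\<close> points from \<open>P s\<close> to the inclusion, the direction in which the
  covariant \<open>X\<close> transports elements, so it straightens \<open>s\<close> to a strict
  section.\<close>

lemma dsecat_el_proj_eq_0_iff:
  assumes C: "category C" and X: "set_functor C X"
  shows "dsecat (elements C X) C (el_proj C X) = 0 \<longleftrightarrow> lim_set C X \<noteq> {}"
proof
  assume "lim_set C X \<noteq> {}"
  then obtain s where s: "s \<in> Sect (elements C X) C (el_proj C X)"
    using section_of_in_Sect[OF C] by blast
  have "subcategory C C"
    using C by (auto simp: subcategory_def)
  moreover have "nat_trans C C (id_functor C) (id_functor C) (Ident C)"
    using catD[OF C] by (auto simp: nat_trans_def id_functor_def)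
  ultimately show "dsecat (elements C X) C (el_proj C X) = 0"
    using s unfolding dsecat_eq_0_iff Sect_def by (metis (mono_tags, lifting) mem_Collect_eq subset_refl)
next
  assume "dsecat (elements C X) C (el_proj C X) = 0"
  then obtain U s t where U: "subcategory U C" "Arr C \<subseteq> Arr U"
    and s: "is_functor U (elements C X) s"
    and t: "nat_trans U C (comp_functor U (el_proj C X) s) (id_functor U) t"
    unfolding dsecat_eq_0_iff by blast
  have arrU: "Arr U = Arr C" and domU: "f \<in> Arr C \<Longrightarrow> Dom U f = Dom C f \<and> Cod U f = Cod C f" for f
    using U by (auto simp: subcategory_def)
  have objU: "Obj U = Obj C"
  proof
    \<comment> \<open>Covers constrain only morphisms; an object is recovered as the domain of its
      identity.\<close>
    show "Obj C \<subseteq> Obj U"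
    proof
      fix c assume c: "c \<in> Obj C"
      have "Dom U (Ident C c) \<in> Obj U"
        using U(1) catD(1)[of U "Ident C c"] catD(3)[OF C c] arrU by (simp add: subcategory_def)
      then show "c \<in> Obj U"
        using c catD[OF C] domU by simp
    qed
  qed (use U in \<open>auto simp: subcategory_def\<close>)
  \<comment> \<open>On objects \<open>s\<close> is \<open>c \<mapsto> (a c, y c)\<close>, and
    \<open>g f\<close> is the morphism of \<open>C\<close> underlying the image of \<open>f\<close>;
    hence \<open>t c\<close> goes from \<open>a c\<close> to \<open>c\<close>.\<close>
  define a where "a c = fst (fobj s c)" for c
  define y where "y c = snd (fobj s c)" for c
  define g where "g f = fst (snd (farr s f))" for f
  have ay: "fobj s c = (a c, y c)" "a c \<in> Obj C" "y c \<in> sobj X (a c)" if "c \<in> Obj C" for c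
  proof -
    have "fobj s c \<in> Obj (elements C X)"
      using is_functorD(1)[OF s] that objU by simp
    then show "fobj s c = (a c, y c)" "a c \<in> Obj C" "y c \<in> sobj X (a c)"
      by (auto simp: elements_def a_def y_def)
  qed
  have sf: "g f \<in> Arr C" "Dom C (g f) = a (Dom C f)" "Cod C (g f) = a (Cod C f)"
    "sarr X (g f) (y (Dom C f)) = y (Cod C f)"
    "farr s f = (fobj s (Dom C f), g f, fobj s (Cod C f))" if "f \<in> Arr C" for f
  proof -
    have sf: "farr s f \<in> Arr (elements C X)"
      "Dom (elements C X) (farr s f) = fobj s (Dom C f)"
      "Cod (elements C X) (farr s f) = fobj s (Cod C f)"
      using is_functorD(2-4)[OF s, of f] that arrU domU[OF that] by simp_all
    obtain p h q where "farr s f = (p, h, q)"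
      by (cases "farr s f")
    with sf show "g f \<in> Arr C" "Dom C (g f) = a (Dom C f)" "Cod C (g f) = a (Cod C f)"
      "sarr X (g f) (y (Dom C f)) = y (Cod C f)"
      "farr s f = (fobj s (Dom C f), g f, fobj s (Cod C f))"
      by (auto simp: elements_def a_def y_def g_def)
  qed
  have tc: "t c \<in> Arr C" "Dom C (t c) = a c" "Cod C (t c) = c" if "c \<in> Obj C" for c
    using t that ay[OF that] objU
    by (auto simp: nat_trans_def comp_functor_def id_functor_def el_proj_def elements_def)
  have tn: "Comp C (t (Cod C f)) (g f) = Comp C f (t (Dom C f))" if f: "f \<in> Arr C" for f
  proof -
    have "farr s f \<in> Arr (elements C X)"
      using is_functorD(2)[OF s] f arrU by simp
    then have "farr (el_proj C X) (farr s f) = g f"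
      by (simp add: el_proj_def g_def case_prod_beta)
    then show ?thesis
      using t f arrU domU[OF f] by (auto simp: nat_trans_def comp_functor_def id_functor_def)
  qed
  \<comment> \<open>The transport of \<open>y c\<close> from the fibre over \<open>a c\<close> to
    the fibre over \<open>c\<close>.\<close>
  define x where "x = (\<lambda>c\<in>Obj C. sarr X (t c) (y c))"
  have "sarr X f (x (Dom C f)) = x (Cod C f)" if f: "f \<in> Arr C" for f
  proof -
    note o = catD(1)[OF C f] catD(2)[OF C f]
    have "sarr X f (x (Dom C f)) = sarr X (Comp C f (t (Dom C f))) (y (Dom C f))"
      using f o tc[OF o(1)] ay[OF o(1)] set_functorD(3)[OF X] by (simp add: x_def)
    \<comment> \<open>Naturality of \<open>t\<close> trades \<open>f\<close> for \<open>g f\<close>,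
      along which \<open>y\<close> is already compatible.\<close>
    also have "\<dots> = sarr X (Comp C (t (Cod C f)) (g f)) (y (Dom C f))"
      by (simp add: tn[OF f])
    also have "\<dots> = sarr X (t (Cod C f)) (y (Cod C f))"
      using sf[OF f] o tc[OF o(2)] ay[OF o(1)] set_functorD(3)[OF X, of "g f" "t (Cod C f)"] by simp
    finally show ?thesis
      using o by (simp add: x_def)
  qed
  moreover have "x c \<in> sobj X c" if "c \<in> Obj C" for c
    using set_functorD(1)[OF X, of "t c" "y c"] tc[OF that] ay[OF that] that by (simp add: x_def)
  ultimately have "x \<in> lim_set C X"
    by (auto simp: lim_set_def x_def)
  then show "lim_set C X \<noteq> {}"
    by blast
qed

text \<open>\<open>\<Phi>\<close> takes \<open>R\<close> and \<open>e\<close> as arguments because a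
  right Kan extension is determined only up to isomorphism; it is chosen before all of them, so that
  one family is both bijective and natural.\<close>

theorem proposition7p9:
  fixes C :: "('o, 'a) cat" and D :: "('p, 'b) cat" and F :: "('o, 'a, 'p, 'b) func"
  assumes "category C" and "category D" and "is_functor C D F"
  shows
    "(\<exists>\<Phi>.
        (\<forall>(X :: ('o, 'a, 'x) setfun) (R :: ('p, 'b, 'y) setfun) e.
           set_functor C X \<and> right_kan_extension C D F X R e \<longrightarrow>
             bij_betw (\<Phi> X R e)
               (Sect (elements C X) C (el_proj C X))
               (Sect (elements D R) D (el_proj D R))) \<and>
        (\<forall>(X :: ('o, 'a, 'x) setfun) (R :: ('p, 'b, 'y) setfun) e X' R' e' t.
           set_functor C X \<and> right_kan_extension C D F X R e \<and>
           set_functor C X' \<and> right_kan_extension C D F X' R' e' \<and>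
           t \<in> set_nat C X X' \<longrightarrow>
             (\<forall>s \<in> Sect (elements C X) C (el_proj C X).
                \<Phi> X' R' e' (sect_map C X t s) =
                sect_map D R (ran_map C D F R e R' e' t) (\<Phi> X R e s)))) \<and>
     (\<forall>(X :: ('o, 'a, 'x) setfun) (R :: ('p, 'b, 'y) setfun) e.
        set_functor C X \<and> right_kan_extension C D F X R e \<longrightarrow>
          (dsecat (elements C X) C (el_proj C X) = 0 \<longleftrightarrow>
           dsecat (elements D R) D (el_proj D R) = 0))"
proof (intro conjI allI impI)
  note C = assms(1) and D = assms(2) and F = assms(3)
  \<comment> \<open>Section to family over \<open>C\<close>, back along the comparison of limits,
    then family over \<open>D\<close> to section.\<close>
  define \<Phi> where "\<Phi> = (\<lambda>(X :: ('o, 'a, 'x) setfun) (R :: ('p, 'b, 'y) setfun)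
      (e :: 'o \<Rightarrow> 'y \<Rightarrow> 'x) s.
    section_of D (inv_into (lim_set D R) (lim_restrict C F e) (family_of C s)))"
  have bij: "bij_betw (\<Phi> X R e)
      (Sect (elements C X) C (el_proj C X)) (Sect (elements D R) D (el_proj D R))"
    if "right_kan_extension C D F X R e"
    for X :: "('o, 'a, 'x) setfun" and R :: "('p, 'b, 'y) setfun" and e
    using bij_betw_trans[OF bij_betw_trans[OF bij_betw_family_of[OF C]
          bij_betw_inv_into[OF bij_betw_lim_restrict[OF C D F that]]] bij_betw_section_of[OF D]]
    by (simp add: \<Phi>_def o_def)
  \<comment> \<open>A description of \<open>\<Phi>\<close> free of \<open>inv_into\<close>: every
    section over \<open>C\<close> comes from some \<open>r\<close> in the limit of \<open>R\<close>,
    so naturality reduces to an equation in \<open>r\<close>.\<close>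
  have \<Phi>_eq: "\<Phi> X R e (section_of C (lim_restrict C F e r)) = section_of D r"
    if ran: "right_kan_extension C D F X R e" and r: "r \<in> lim_set D R"
    for X :: "('o, 'a, 'x) setfun" and R :: "('p, 'b, 'y) setfun" and e r
    using bij_betw_lim_restrict[OF C D F ran] r
    by (simp add: \<Phi>_def bij_betwE family_of_section_of[where X = X] bij_betw_inv_into_left)
  have nat: "\<Phi> X' R' e' (sect_map C X t s) =
      sect_map D R (ran_map C D F R e R' e' t) (\<Phi> X R e s)"
    if ran: "right_kan_extension C D F X R e" and ran': "right_kan_extension C D F X' R' e'"
      and t: "t \<in> set_nat C X X'" and s: "s \<in> Sect (elements C X) C (el_proj C X)"
    for X X' :: "('o, 'a, 'x) setfun" and R R' :: "('p, 'b, 'y) setfun" and e e' t s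
  proof -
    obtain r where r: "r \<in> lim_set D R" and "family_of C s = lim_restrict C F e r"
      using bij_betw_lim_restrict[OF C D F ran] family_of_in_lim_set[OF C s]
      by (auto simp: bij_betw_def)
    then have s_eq: "s = section_of C (lim_restrict C F e r)"
      using section_of_family_of[OF C s] by simp
    let ?d = "ran_map C D F R e R' e' t"
    have "lim_restrict C F e r \<in> lim_set C X"
      using bij_betw_lim_restrict[OF C D F ran] r by (rule bij_betw_apply)
    then have "sect_map C X t s = section_of C (lim_restrict C F e' (lim_map D ?d r))"
      by (simp add: s_eq sect_map_section_of[OF C] lim_restrict_ran_map[OF C F ran ran' t r])
    then have "\<Phi> X' R' e' (sect_map C X t s) = section_of D (lim_map D ?d r)"
      using \<Phi>_eq[OF ran' lim_map_in_lim_set[OF D ran_map_in_set_nat[OF C F ran ran' t] r]] by simp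
    also have "\<dots> = sect_map D R ?d (\<Phi> X R e s)"
      by (simp add: s_eq \<Phi>_eq[OF ran r] sect_map_section_of[OF D r])
    finally show ?thesis .
  qed
  show "\<exists>\<Phi>.
        (\<forall>(X :: ('o, 'a, 'x) setfun) (R :: ('p, 'b, 'y) setfun) e.
           set_functor C X \<and> right_kan_extension C D F X R e \<longrightarrow>
             bij_betw (\<Phi> X R e)
               (Sect (elements C X) C (el_proj C X))
               (Sect (elements D R) D (el_proj D R))) \<and>
        (\<forall>(X :: ('o, 'a, 'x) setfun) (R :: ('p, 'b, 'y) setfun) e X' R' e' t.
           set_functor C X \<and> right_kan_extension C D F X R e \<and>
           set_functor C X' \<and> right_kan_extension C D F X' R' e' \<and>
           t \<in> set_nat C X X' \<longrightarrow>
             (\<forall>s \<in> Sect (elements C X) C (el_proj C X).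
                \<Phi> X' R' e' (sect_map C X t s) =
                sect_map D R (ran_map C D F R e R' e' t) (\<Phi> X R e s)))"
    using bij nat by (intro exI[of _ \<Phi>]) blast
next
  fix X :: "('o, 'a, 'x) setfun" and R :: "('p, 'b, 'y) setfun" and e
  assume *: "set_functor C X \<and> right_kan_extension C D F X R e"
  then have "set_functor D R"
    by (simp add: right_kan_extension_def)
  \<comment> \<open>Only the existence of a section matters here, and a bijection preserves
    emptiness.\<close>
  moreover have "lim_set C X = {} \<longleftrightarrow> lim_set D R = {}"
    using bij_betw_lim_restrict[OF assms conjunct2[OF *]] by (auto simp: bij_betw_def)
  ultimately show "dsecat (elements C X) C (el_proj C X) = 0 \<longleftrightarrow>
      dsecat (elements D R) D (el_proj D R) = 0"
    using * assms by (simp add: dsecat_el_proj_eq_0_iff)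
qed

end
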